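(* For every integer $p\ge1$, as formal power series in $t$, \[ \sum_{n=0}^{\infty}\mathrm{Bel}_{n,\lambda}^{(p)}\frac{t^{n}}{n!}=(-1)^{p-1}p\,e^{e_{\lambda}(t)-1}\bigg(e_{\lambda}^{\lambda-1}(t)\frac{d}{dt}\bigg)^{p-1}\bigg(\frac{1-e^{1-e_{\lambda}(t)}}{e_{\lambda}(t)-1}\bigg), \] where $\frac{1-e^{1-e_{\lambda}(t)}}{e_{\lambda}(t)-1}$ denotes the formal power series in $t$ obtained by removing the (removable) singularity at $t=0$, and $\big(e_{\lambda}^{\lambda-1}(t)\frac{d}{dt}\big)^{p-1}$ is the $(p-1)$-fold iterate of the operator $f(t)\mapsto e_{\lambda}^{\lambda-1}(t)f'(t)$.
   Context: Let $\lambda\in\mathbb{R}$. Set $(x)_{0,\lambda}=1$, $(x)_{n,\lambda}=x(x-\lambda)\cdots(x-(n-1)\lambda)$ for $n\ge1$. The degenerate exponential is the formal power series $e_\lambda^x(t)=\sum_{n\ge0}(x)_{n,\lambda}\frac{t^n}{n!}$ ($=(1+\lambda t)^{x/\lambda}$, and $e^{xt}$ if $\lambda=0$), $e_\lambda(t)=e_\lambda^1(t)$; in particular $e_\lambda^{\lambda-1}(t)=(1+\lambda t)^{(\lambda-1)/\lambda}$. For an integer $p\ge0$, the truncated degenerate Bell numbers $\mathrm{Bel}^{(p)}_{n,\lambda}$ are defined by $\sum_{n\ge0}\mathrm{Bel}^{(p)}_{n,\lambda}\frac{t^n}{n!}=\frac{p!}{(e_\lambda(t)-1)^p}\Big(e^{e_\lambda(t)-1}-\sum_{k=0}^{p-1}\frac{(e_\lambda(t)-1)^k}{k!}\Big)=p!\sum_{k\ge0}\frac{(e_\lambda(t)-1)^k}{(k+p)!}$.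 *)

theory Defs
  imports Complex_Main "HOL-Computational_Algebra.Formal_Power_Series"
begin

definition degen_fall :: "real \<Rightarrow> real \<Rightarrow> nat \<Rightarrow> real" where
  "degen_fall lam x n = (\<Prod>i<n. x - real i * lam)"

definition degen_exp :: "real \<Rightarrow> real \<Rightarrow> real fps" where
  "degen_exp lam x = Abs_fps (\<lambda>n. degen_fall lam x n / fact n)"

(* e_lam(t) - 1; its constant term is 0, so it may be substituted into a power series with oo *)
definition degen_u :: "real \<Rightarrow> real fps" where
  "degen_u lam = degen_exp lam 1 - 1"

(* Division of formal power series is exact when the divisor divides the dividend, so the whole
   numerator has to be divided by the p-th power; 1 / degen_u lam ^ p alone is not a power series. *)
definition trunc_bell_gf :: "nat \<Rightarrow> real \<Rightarrow> real fps" where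
  "trunc_bell_gf p lam =
     (fact p * ((fps_exp 1 oo degen_u lam) - (\<Sum>k<p. fps_const (1 / fact k) * degen_u lam ^ k)))
       / degen_u lam ^ p"

definition trunc_bell :: "nat \<Rightarrow> nat \<Rightarrow> real \<Rightarrow> real" where
  "trunc_bell p n lam = fact n * fps_nth (trunc_bell_gf p lam) n"

definition degen_D :: "real \<Rightarrow> real fps \<Rightarrow> real fps" where
  "degen_D lam f = degen_exp lam (lam - 1) * fps_deriv f"

definition quot_series :: "real \<Rightarrow> real fps" where
  "quot_series lam = (1 - (fps_exp 1 oo (1 - degen_exp lam 1))) / degen_u lam"

lemma degen_u_nth_0: "fps_nth (degen_u lam) 0 = 0"
  by (simp add: degen_u_def degen_exp_def degen_fall_def)

lemma degen_u_nonzero: "degen_u lam \<noteq> 0"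
proof -
  have "fps_nth (degen_u lam) 1 = 1"
    by (simp add: degen_u_def degen_exp_def degen_fall_def)
  then show ?thesis by auto
qed

(* Both divisions above are exact. *)

lemma quot_series_times:
  "quot_series lam * degen_u lam = 1 - (fps_exp 1 oo (1 - degen_exp lam 1))"
proof -
  let ?h = "fps_shift 1 (1 - fps_exp (-1)) :: real fps"
  have e: "1 - degen_exp lam 1 = - fps_X oo degen_u lam"
    by (simp add: degen_u_def fps_compose_uminus degen_exp_def degen_fall_def)
  have "fps_exp 1 oo (1 - degen_exp lam 1) = (fps_exp 1 oo - fps_X) oo degen_u lam"
    unfolding e by (rule fps_compose_assoc) (simp_all add: degen_u_nth_0)
  also have "(fps_exp 1 oo - fps_X) = (fps_exp (-1) :: real fps)"
    using fps_exp_compose_linear[of 1 "-1::real"]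
    by (simp flip: fps_const_neg add: fps_const_1_eq_1)
  finally have *: "fps_exp 1 oo (1 - degen_exp lam 1) = fps_exp (-1) oo degen_u lam" .
  have "1 - fps_exp (-1) = ?h * (fps_X :: real fps)"
    by (rule fps_ext) auto
  then have "(1 - fps_exp (-1)) oo degen_u lam = (?h * fps_X) oo degen_u lam"
    by (rule arg_cong)
  also have "\<dots> = (?h oo degen_u lam) * degen_u lam"
    by (simp add: fps_compose_mult_distrib degen_u_nth_0 del: One_nat_def)
  finally have "1 - (fps_exp 1 oo (1 - degen_exp lam 1)) = (?h oo degen_u lam) * degen_u lam"
    by (simp add: * fps_compose_sub_distrib)
  then show ?thesis
    unfolding quot_series_def by (simp add: degen_u_nonzero)
qed

lemma trunc_bell_gf_series:
  "trunc_bell_gf p lam = Abs_fps (\<lambda>k. fact p / fact (k + p)) oo degen_u lam"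
proof -
  let ?h = "Abs_fps (\<lambda>k. fact p / fact (k + p)) :: real fps"
  have "fact p * (fps_exp 1 - (\<Sum>k<p. fps_const (1 / fact k) * fps_X ^ k)) = ?h * fps_X ^ p"
  proof (rule fps_ext)
    fix n
    have "fps_nth (\<Sum>k<p. fps_const (1 / fact k :: real) * fps_X ^ k) n
        = (if n < p then 1 / fact n else 0)"
      by (simp add: fps_sum_nth fps_X_power_nth if_distrib[of "\<lambda>x. _ * x"] cong: if_cong)
    moreover have "(fact p :: real fps) = fps_const (fact p)"
      by (metis fps_of_nat of_nat_fact)
    ultimately show "fps_nth (fact p * (fps_exp 1 - (\<Sum>k<p. fps_const (1 / fact k) * fps_X ^ k))) n
        = fps_nth (?h * fps_X ^ p) n"
      by (auto simp: fps_X_power_mult_right_nth)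
  qed
  then have "(fact p * (fps_exp 1 - (\<Sum>k<p. fps_const (1 / fact k) * fps_X ^ k))) oo degen_u lam
      = (?h oo degen_u lam) * degen_u lam ^ p"
    by (simp add: fps_compose_mult_distrib degen_u_nth_0 fps_compose_power[symmetric])
  moreover have "(fact p * (fps_exp 1 - (\<Sum>k<p. fps_const (1 / fact k) * fps_X ^ k))) oo degen_u lam
      = fact p * ((fps_exp 1 oo degen_u lam) - (\<Sum>k<p. fps_const (1 / fact k) * degen_u lam ^ k))"
  proof -
    have "(fact p :: real fps) = fps_const (fact p)"
      by (metis fps_of_nat of_nat_fact)
    then show ?thesis
      by (simp add: fps_compose_mult_distrib degen_u_nth_0 fps_compose_sub_distrib
          fps_compose_sum_distrib fps_compose_power[symmetric])
  qed
  ultimately show ?thesis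
    unfolding trunc_bell_gf_def by (simp add: degen_u_nonzero)
qed

end

theory Submission
  imports Defs
begin

text \<open>
  Since \<open>d/dt e\<^sub>\<lambda>(t) = e\<^sub>\<lambda>\<^sup>1\<^sup>-\<^sup>\<lambda>(t)\<close>, the operator \<open>e\<^sub>\<lambda>\<^sup>\<lambda>\<^sup>-\<^sup>1(t) d/dt\<close> is differentiation with
  respect to \<open>u = e\<^sub>\<lambda>(t) - 1\<close>, and the claim becomes an identity between power series in \<open>u\<close>.
  With \<open>T\<^sub>q(u) = \<Sum>\<^sub>k q! u\<^sup>k / (k + q + 1)!\<close> one has \<open>T\<^sub>q' = T\<^sub>q - T\<^sub>q\<^sub>+\<^sub>1\<close>, so
  \<open>(e\<^sup>-\<^sup>u T\<^sub>q)' = - e\<^sup>-\<^sup>u T\<^sub>q\<^sub>+\<^sub>1\<close>. Here \<open>e\<^sup>-\<^sup>u T\<^sub>0 = (1 - e\<^sup>-\<^sup>u) / u\<close>, while \<open>p T\<^sub>p\<^sub>-\<^sub>1\<close> is the generating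
  function of the truncated Bell numbers.
\<close>

text \<open>In closed form, q! (e^u - sum_{j <= q} u^j / j!) / u^(q+1).\<close>

definition exp_tail :: "nat \<Rightarrow> real fps" where
  "exp_tail q = Abs_fps (\<lambda>k. fact q / fact (k + q + 1))"

text \<open>Over the common denominator \<open>fact (k + q + 2)\<close> this is k + 1 = (k + q + 2)
  - (q + 1).\<close>

lemma fps_deriv_exp_tail: "fps_deriv (exp_tail q) = exp_tail q - exp_tail (Suc q)"
proof (rule fps_ext)
  fix k
  have "fact (k + q + 2) = (real k + real q + 2) * fact (k + q + 1)"
    by (simp add: algebra_simps)
  then show "fps_nth (fps_deriv (exp_tail q)) k = fps_nth (exp_tail q - exp_tail (Suc q)) k"
    by (simp add: exp_tail_def divide_simps add_nonneg_eq_0_iff) (simp add: algebra_simps)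
qed

lemma fps_deriv_exp_times_exp_tail:
  "fps_deriv (fps_exp (-1) * exp_tail q) = - (fps_exp (-1) * exp_tail (Suc q))"
  by (simp add: fps_deriv_exp_tail algebra_simps flip: fps_const_neg)

lemma exp_tail_0_times_X: "exp_tail 0 * fps_X = fps_exp 1 - 1"
  by (rule fps_ext) (auto simp: exp_tail_def fps_X_mult_right_nth fact_reduce)

lemma degen_exp_nth_0 [simp]: "fps_nth (degen_exp lam x) 0 = 1"
  by (simp add: degen_exp_def degen_fall_def)

text \<open>The differential equation of (1 + lam t)^(x/lam), valid also for lam = 0; on
  coefficients it is the recurrence (x)_{n+1} = (x - n lam) (x)_n.\<close>

lemma fps_deriv_degen_exp:
  "(1 + fps_const lam * fps_X) * fps_deriv (degen_exp lam x) = fps_const x * degen_exp lam x"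
proof (rule fps_ext)
  fix n
  show "fps_nth ((1 + fps_const lam * fps_X) * fps_deriv (degen_exp lam x)) n
      = fps_nth (fps_const x * degen_exp lam x) n"
    by (cases n) (simp_all add: degen_exp_def degen_fall_def distrib_right mult.assoc
        fps_X_mult_nth, simp add: divide_simps add_nonneg_eq_0_iff, simp add: algebra_simps)
qed

lemma fps_deriv_degen_exp_1: "fps_deriv (degen_exp lam 1) = degen_exp lam (1 - lam)"
proof (rule fps_ext)
  fix n
  have "degen_fall lam 1 (Suc n) = degen_fall lam (1 - lam) n"
    unfolding degen_fall_def prod.lessThan_Suc_shift by (simp add: algebra_simps)
  then show "fps_nth (fps_deriv (degen_exp lam 1)) n = fps_nth (degen_exp lam (1 - lam)) n"
    by (simp add: degen_exp_def divide_simps add_nonneg_eq_0_iff)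
qed

text \<open>By the differential equations of the factors, the product has derivative 0, so it equals
  its constant term.\<close>

lemma degen_exp_mult_neg: "degen_exp lam x * degen_exp lam (-x) = 1"
proof -
  let ?c = "1 + fps_const lam * fps_X :: real fps"
  let ?P = "degen_exp lam x * degen_exp lam (-x)"
  have "?c * fps_deriv ?P = (?c * fps_deriv (degen_exp lam x)) * degen_exp lam (-x)
      + degen_exp lam x * (?c * fps_deriv (degen_exp lam (-x)))"
    by (simp add: algebra_simps)
  also have "\<dots> = 0"
    unfolding fps_deriv_degen_exp by (simp flip: fps_const_neg)
  finally have "?c * fps_deriv ?P = 0" .
  moreover have "fps_nth ?c 0 = 1"
    by simp
  then have "?c \<noteq> 0"
    by (metis fps_zero_nth zero_neq_one)
  ultimately have "fps_deriv ?P = 0"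
    by (metis mult_eq_0_iff)
  then have "?P = fps_const (fps_nth ?P 0)"
    by (simp only: fps_deriv_eq_0_iff)
  then show ?thesis
    by simp
qed

text \<open>Chain rule: the prefactor in \<open>degen_D\<close> is the reciprocal of the derivative
  of \<open>degen_u lam\<close>.\<close>

lemma degen_D_compose: "degen_D lam (f oo degen_u lam) = fps_deriv f oo degen_u lam"
proof -
  have "degen_exp lam (lam - 1) * fps_deriv (degen_u lam) = 1"
    using degen_exp_mult_neg[of lam "lam - 1"]
    by (simp add: degen_u_def fps_deriv_degen_exp_1)
  then show ?thesis
    by (simp add: degen_D_def fps_compose_deriv degen_u_nth_0 mult.left_commute)
qed

text \<open>Multiplied by u, both sides become 1 - e^(-u); then u is cancelled.\<close>

lemma quot_series_eq: "quot_series lam = fps_exp (-1) * exp_tail 0 oo degen_u lam"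
proof -
  let ?u = "degen_u lam"
  have inv: "fps_exp (-1) * fps_exp 1 = (1 :: real fps)"
    by (simp flip: fps_exp_add_mult)
  have "(fps_exp 1 oo - fps_X) oo ?u = fps_exp 1 oo (- fps_X oo ?u)"
    by (rule fps_compose_assoc [symmetric]) (simp_all add: degen_u_nth_0)
  moreover have "- fps_X oo ?u = 1 - degen_exp lam 1"
    by (simp add: fps_compose_uminus degen_u_nth_0) (simp add: degen_u_def)
  moreover have "fps_exp 1 oo - fps_X = (fps_exp (-1) :: real fps)"
    using fps_exp_compose_linear[of 1 "-1 :: real"]
    by (simp flip: fps_const_neg add: fps_const_1_eq_1)
  ultimately have "quot_series lam * ?u = (1 - fps_exp (-1)) oo ?u"
    by (simp add: quot_series_times fps_compose_sub_distrib)
  also have "1 - fps_exp (-1) = fps_exp (-1) * exp_tail 0 * fps_X"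
    by (simp add: mult.assoc exp_tail_0_times_X right_diff_distrib inv)
  also have "(\<dots> oo ?u) = (fps_exp (-1) * exp_tail 0 oo ?u) * ?u"
    by (simp add: fps_compose_mult_distrib[of ?u _ fps_X] degen_u_nth_0)
  finally show ?thesis
    using degen_u_nonzero by simp
qed

lemma degen_D_funpow_quot_series:
  "(degen_D lam ^^ q) (quot_series lam)
    = (-1) ^ q * (fps_exp (-1) * exp_tail q oo degen_u lam)"
proof (induction q)
  case 0
  show ?case
    by (simp add: quot_series_eq)
next
  case (Suc q)
  \<comment> \<open>The sign is a constant series, so \<open>degen_D\<close> commutes with
    it.\<close>
  have "(-1 :: real fps) ^ q = fps_const ((-1) ^ q)"
    by (simp flip: fps_const_power fps_const_neg)
  then have "degen_D lam ((-1) ^ q * f) = (-1) ^ q * degen_D lam f" for f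
    by (simp add: degen_D_def mult.left_commute)
  then show ?case
    by (simp add: Suc degen_D_compose fps_deriv_exp_times_exp_tail fps_compose_uminus
        del: fps_deriv_mult)
qed

theorem theorem7:
  fixes lam :: real and p :: nat
  assumes "p \<ge> 1"
  shows "Abs_fps (\<lambda>n. trunc_bell p n lam / fact n) =
    (-1) ^ (p - 1) * of_nat p * (fps_exp 1 oo (degen_exp lam 1 - 1)) *
      ((degen_D lam) ^^ (p - 1)) (quot_series lam)"
proof -
  let ?u = "degen_u lam"
  obtain q where p: "p = Suc q"
    using assms by (cases p) auto
  have [simp]: "fps_nth ?u 0 = 0"
    by (rule degen_u_nth_0)
  have inv: "fps_exp 1 * fps_exp (-1) = (1 :: real fps)"
    by (simp flip: fps_exp_add_mult)
  have "Abs_fps (\<lambda>k. fact p / fact (k + p)) = fps_const (real p) * exp_tail q"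
    by (rule fps_ext) (simp add: exp_tail_def p)
  then have "Abs_fps (\<lambda>n. trunc_bell p n lam / fact n) = fps_const (real p) * exp_tail q oo ?u"
    by (simp add: trunc_bell_def trunc_bell_gf_series fps_nth_inverse)
  also have "\<dots> = of_nat p * (exp_tail q oo ?u)"
    by (simp add: fps_compose_mult_distrib flip: fps_of_nat)
  \<comment> \<open>Inserting e^u e^(-u) = 1 exposes the series produced by iterating
    \<open>degen_D\<close>.\<close>
  also have "exp_tail q = fps_exp 1 * (fps_exp (-1) * exp_tail q)"
    by (simp add: inv flip: mult.assoc)
  also have "(\<dots> oo ?u) = (fps_exp 1 oo ?u) * (fps_exp (-1) * exp_tail q oo ?u)"
    by (rule fps_compose_mult_distrib) simp
  \<comment> \<open>The two signs multiply to 1.\<close>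
  also have "of_nat p * \<dots> = (-1) ^ q * of_nat p * (fps_exp 1 oo ?u)
      * ((-1) ^ q * (fps_exp (-1) * exp_tail q oo ?u))"
    by (simp add: mult_ac flip: power_add mult_2)
  finally show ?thesis
    by (simp add: p degen_D_funpow_quot_series degen_u_def)
qed

end
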